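(* Let $m_1,m_2,m_3>0$ be masses and let $\sigma_{12},\sigma_{23},\sigma_{31}\in(0,\pi)$ be arc angles satisfying $\sigma_{ij}\le\sigma_{jk}+\sigma_{ki}$ for $(i,j,k)\in\{(1,2,3),(2,3,1),(3,1,2)\}$ and $\sigma_{12}+\sigma_{23}+\sigma_{31}\le2\pi$. The necessary and sufficient condition for the set $\{m_k,\cos\sigma_{ij}\}$ to form a Lagrange relative equilibrium is that the matrix $J$ has the eigenvector $$\Psi_L=\left(\frac{\sqrt{m_1}}{U'(\cos\sigma_{23})},\ \frac{\sqrt{m_2}}{U'(\cos\sigma_{31})},\ \frac{\sqrt{m_3}}{U'(\cos\sigma_{12})}\right)^T\Big/\left(\sum_{(i,j,k)}\frac{m_k}{(U'(\cos\sigma_{ij}))^2}\right)^{1/2},$$ where the sum runs over $(i,j,k)\in\{(1,2,3),(2,3,1),(3,1,2)\}$.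
   Context: Three point particles with masses $m_k>0$ move on the unit sphere $\mathbb{S}^2\subset\mathbb{R}^3$ at positions $q_k$, $|q_k|=1$. The arc angle $\sigma_{ij}=\sigma_{ji}\in(0,\pi)$ is defined by $\cos\sigma_{ij}=q_i\cdot q_j$. The motion is governed by the Euler–Lagrange equations on $(\mathbb{S}^2)^3$ of $L=\sum_k\frac{m_k}{2}|\dot q_k|^2+\sum_{i<j}m_im_jU(\cos\sigma_{ij})$, where the derivative $U'$ of $U$ with respect to its argument $\cos\sigma_{ij}$ is continuous and has definite sign (nowhere zero, of constant sign) for all $\sigma_{ij}\in(0,\pi)$; $U'>0$ corresponds to an attractive force and $U'<0$ to a repulsive force. A relative equilibrium is a solution with $\dot q_k=\Omega\times q_k$ for all $k$, where $\Omega\in\mathbb{R}^3$ is a constant vector. It is a Lagrange relative equilibrium if the three bodies are not all on the same geodesic (great circle). The set $\{m_k,\cos\sigma_{ij}\}$ forms a Lagrange relative equilibrium if there is a Lagrange relative equilibrium of bodies with masses $m_1,m_2,m_3$ whose mutual arc angles are $\sigma_{12},\sigma_{23},\sigma_{31}$. The matrix $J$ is the $3\times3$ symmetric matrix $J_{ij}=M\delta_{ij}-\sqrt{m_im_j}\,(q_i\cdot q_j)$ with $M=m_1+m_2+m_3$ and $\delta_{ij}$ the Kronecker delta; i.e. its diagonal entries are $m_2+m_3,\ m_3+m_1,\ m_1+m_2$ and its off-diagonal entries are $-\sqrt{m_im_j}\cos\sigma_{ij}$.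
   Formalization: Sufficiency fails for repulsive forces (equal masses, all angles π/2, U(c)=-c) and when an angle inequality is an equality; so the condition proved equivalent is: Ψ_L is an eigenvector of J, U'>0, and all triangle and perimeter inequalities are strict. *)

theory Defs
  imports "HOL-Analysis.Analysis"
begin

text \<open>
  A configuration of three bodies is a value \<open>x :: real^3^3\<close>: the outer index (of type \<open>3\<close>)
  names the body, so \<open>x $ k :: real^3\<close> is the position of body \<open>k\<close>.  In the type \<open>3\<close> the
  numeral \<open>3\<close> equals \<open>0\<close>, so the order of that type must not be used for pairs \<open>i < j\<close>;
  the three pairs are listed explicitly instead.
\<close>

definition lagrangian ::
  "real^3 \<Rightarrow> (real \<Rightarrow> real) \<Rightarrow> real^3^3 \<Rightarrow> real^3^3 \<Rightarrow> real" where
  "lagrangian m U x v =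
     (\<Sum>k\<in>UNIV. m $ k / 2 * (norm (v $ k))\<^sup>2) +
     (\<Sum>(i, j)\<in>{(1, 2), (2, 3), (3, 1)}. m $ i * m $ j * U (x $ i \<bullet> x $ j))"

text \<open>
  Euler--Lagrange equations on the submanifold of configurations with all bodies on the unit
  sphere, for a Lagrangian \<open>L x v\<close> given on the ambient space: the covector
  \<open>d/dt (\<partial>L/\<partial>v) - \<partial>L/\<partial>x\<close> must vanish on the tangent space at \<open>q t\<close>, which consists of
  the \<open>w\<close> with \<open>w $ k\<close> orthogonal to \<open>q t $ k\<close> for every \<open>k\<close>.
\<close>
definition euler_lagrange_on_spheres ::
  "(real^3^3 \<Rightarrow> real^3^3 \<Rightarrow> real) \<Rightarrow> (real \<Rightarrow> real^3^3) \<Rightarrow> bool" where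
  "euler_lagrange_on_spheres L q \<longleftrightarrow>
     (\<forall>t k. q t $ k \<in> sphere 0 1) \<and>
     (\<forall>t. q differentiable (at t)) \<and>
     (\<forall>t w. (\<forall>k. w $ k \<bullet> q t $ k = 0) \<longrightarrow>
        ((\<lambda>s. frechet_derivative (\<lambda>v. L (q s) v) (at (vector_derivative q (at s))) w)
           has_real_derivative
         frechet_derivative (\<lambda>x. L x (vector_derivative q (at t))) (at (q t)) w) (at t))"

definition arc_angle :: "real^3 \<Rightarrow> real^3 \<Rightarrow> real" where
  "arc_angle x y = arccos (x \<bullet> y)"

definition is_great_circle :: "(real^3) set \<Rightarrow> bool" where
  "is_great_circle C \<longleftrightarrow> (\<exists>n. n \<noteq> 0 \<and> C = {x \<in> sphere 0 1. n \<bullet> x = 0})"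

definition relative_equilibrium ::
  "real^3 \<Rightarrow> (real \<Rightarrow> real) \<Rightarrow> (real \<Rightarrow> real^3^3) \<Rightarrow> bool" where
  "relative_equilibrium m U q \<longleftrightarrow>
     euler_lagrange_on_spheres (lagrangian m U) q \<and>
     (\<exists>\<Omega>. \<forall>t k. ((\<lambda>s. q s $ k) has_vector_derivative cross3 \<Omega> (q t $ k)) (at t))"

definition lagrange_relative_equilibrium ::
  "real^3 \<Rightarrow> (real \<Rightarrow> real) \<Rightarrow> (real \<Rightarrow> real^3^3) \<Rightarrow> bool" where
  "lagrange_relative_equilibrium m U q \<longleftrightarrow>
     relative_equilibrium m U q \<and>
     (\<forall>t. \<not> (\<exists>C. is_great_circle C \<and> (\<forall>k. q t $ k \<in> C)))"

definition forms_lagrange_relative_equilibrium ::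
  "real^3 \<Rightarrow> (real \<Rightarrow> real) \<Rightarrow> (3 \<Rightarrow> 3 \<Rightarrow> real) \<Rightarrow> bool" where
  "forms_lagrange_relative_equilibrium m U \<sigma> \<longleftrightarrow>
     (\<exists>q. lagrange_relative_equilibrium m U q \<and>
          (\<forall>t i j. i \<noteq> j \<longrightarrow> arc_angle (q t $ i) (q t $ j) = \<sigma> i j))"

text \<open>The matrix \<open>M \<delta>\<^sub>i\<^sub>j - sqrt (m\<^sub>i m\<^sub>j) (q\<^sub>i \<bullet> q\<^sub>j)\<close>; the values \<open>\<sigma> i i\<close> are not used.\<close>
definition J_matrix :: "real^3 \<Rightarrow> (3 \<Rightarrow> 3 \<Rightarrow> real) \<Rightarrow> real^3^3" where
  "J_matrix m \<sigma> =
     (\<chi> i j. if i = j then (\<Sum>k\<in>UNIV. m $ k) - m $ i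
             else - sqrt (m $ i * m $ j) * cos (\<sigma> i j))"

definition is_eigenvector :: "real^'n^'n \<Rightarrow> real^'n \<Rightarrow> bool" where
  "is_eigenvector A v \<longleftrightarrow> v \<noteq> 0 \<and> (\<exists>\<mu>. A *v v = \<mu> *\<^sub>R v)"

definition Psi_L :: "real^3 \<Rightarrow> (real \<Rightarrow> real) \<Rightarrow> (3 \<Rightarrow> 3 \<Rightarrow> real) \<Rightarrow> real^3" where
  "Psi_L m U' \<sigma> =
     (1 / sqrt (m $ 3 / (U' (cos (\<sigma> 1 2)))\<^sup>2
              + m $ 1 / (U' (cos (\<sigma> 2 3)))\<^sup>2
              + m $ 2 / (U' (cos (\<sigma> 3 1)))\<^sup>2)) *\<^sub>R
     vector [sqrt (m $ 1) / U' (cos (\<sigma> 2 3)),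
             sqrt (m $ 2) / U' (cos (\<sigma> 3 1)),
             sqrt (m $ 3) / U' (cos (\<sigma> 1 2))]"

end

theory Submission
  imports Defs
begin

text \<open>
  Along \<open>q\<^sub>k' = \<Omega> \<times> q\<^sub>k\<close> the acceleration is \<open>(\<Omega> \<bullet> q\<^sub>k) \<Omega>\<close> up to a multiple of \<open>q\<^sub>k\<close>, so the
  Euler--Lagrange equations say that \<open>(\<Omega> \<bullet> q\<^sub>k) \<Omega> - \<Sum>\<^sub>j m\<^sub>j U'\<^sub>k\<^sub>j q\<^sub>j\<close> is parallel to \<open>q\<^sub>k\<close>.
  For bodies not on a great circle the \<open>q\<^sub>j\<close> form a basis; with \<open>\<Omega> = \<Sum>\<^sub>j a\<^sub>j q\<^sub>j\<close> and
  \<open>z\<^sub>k = \<Omega> \<bullet> q\<^sub>k\<close> this is \<open>z\<^sub>k a\<^sub>j = m\<^sub>j U'\<^sub>k\<^sub>j\<close> for \<open>j \<noteq> k\<close>.  Hence \<open>a\<^sub>k = l m\<^sub>k z\<^sub>k\<close> and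
  \<open>U'\<^sub>i\<^sub>j = l z\<^sub>i z\<^sub>j\<close> for a constant \<open>l\<close>, so \<open>z\<^sub>k\<close> is proportional to \<open>1 / U'\<^sub>i\<^sub>j\<close>, and
  \<open>z\<^sub>k = \<Sum>\<^sub>j a\<^sub>j (q\<^sub>j \<bullet> q\<^sub>k)\<close> is the eigenvalue equation.  Positivity of \<open>\<Omega> \<bullet> \<Omega>\<close> forces \<open>l > 0\<close>,
  that is, attraction.  The Gram determinant of the \<open>q\<^sub>k\<close> is the product
  \<open>4 sin s sin (s - \<sigma>\<^sub>1\<^sub>2) sin (s - \<sigma>\<^sub>2\<^sub>3) sin (s - \<sigma>\<^sub>3\<^sub>1)\<close> with \<open>s\<close> half the perimeter, so
  linear independence amounts to strictness of the triangle and perimeter inequalities.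
  Conversely, an eigenvector determines \<open>\<Omega>\<close> up to scale, and rotating a triangle with the
  prescribed sides about \<open>\<Omega>\<close> solves the equations of motion.
\<close>

lemma three_neq: "(1::3) \<noteq> 2" "(2::3) \<noteq> 3" "(3::3) \<noteq> 1" "(1::3) \<noteq> 3" "(2::3) \<noteq> 1" "(3::3) \<noteq> 2"
  by simp_all

lemma lagrangian_expand:
  "lagrangian m U x v =
     (m $ 1 / 2 * (v $ 1 \<bullet> v $ 1) + m $ 2 / 2 * (v $ 2 \<bullet> v $ 2) + m $ 3 / 2 * (v $ 3 \<bullet> v $ 3)) +
     (m $ 1 * m $ 2 * U (x $ 1 \<bullet> x $ 2) + m $ 2 * m $ 3 * U (x $ 2 \<bullet> x $ 3) +
      m $ 3 * m $ 1 * U (x $ 3 \<bullet> x $ 1))"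
  by (simp add: lagrangian_def sum_3 power2_norm_eq_inner)

section \<open>Gram determinants and spherical triangles\<close>

lemma gram_det_eq_triple_square:
  fixes x y z :: "real^3"
  shows "(x \<bullet> cross3 y z)\<^sup>2 =
    (x \<bullet> x) * (y \<bullet> y) * (z \<bullet> z) + 2 * (x \<bullet> y) * (y \<bullet> z) * (z \<bullet> x)
    - (x \<bullet> x) * (y \<bullet> z)\<^sup>2 - (y \<bullet> y) * (z \<bullet> x)\<^sup>2 - (z \<bullet> z) * (x \<bullet> y)\<^sup>2"
  by (simp add: cross3_def inner_vec_def sum_3) algebra

text \<open>Cramer's rule with denominators cleared: it yields the coordinates of \<Omega> in the
  basis of the three positions.\<close>

lemma triple_scaleR_expansion:
  fixes x y z n :: "real^3"
  shows "(x \<bullet> cross3 y z) *\<^sub>R n =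
    (n \<bullet> cross3 y z) *\<^sub>R x + (n \<bullet> cross3 z x) *\<^sub>R y + (n \<bullet> cross3 x y) *\<^sub>R z"
  by (simp add: cross3_def inner_vec_def sum_3 vec_eq_iff forall_3 algebra_simps)

text \<open>Expansion in the dual basis. It shows that a nonzero vector orthogonal to
  \<open>x\<close>, \<open>y\<close> and \<open>z\<close> forces their triple product to
  vanish.\<close>

lemma triple_scaleR_dual_expansion:
  fixes x y z n :: "real^3"
  shows "(x \<bullet> cross3 y z) *\<^sub>R n =
    (n \<bullet> x) *\<^sub>R cross3 y z + (n \<bullet> y) *\<^sub>R cross3 z x + (n \<bullet> z) *\<^sub>R cross3 x y"
  by (simp add: cross3_def inner_vec_def sum_3 vec_eq_iff forall_3 algebra_simps)

text \<open>The determinant factors as \<open>(cos (b - c) - cos a) * (cos a - cos (b + c))\<close>,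
  and sum-to-product turns each factor into two sines.\<close>

lemma spherical_gram_det:
  fixes a b c :: real
  shows "1 + 2 * cos a * cos b * cos c - (cos a)\<^sup>2 - (cos b)\<^sup>2 - (cos c)\<^sup>2 =
    4 * sin ((a + b + c) / 2) * sin ((b + c - a) / 2) * sin ((c + a - b) / 2) * sin ((a + b - c) / 2)"
proof -
  have p: "cos a - cos (b + c) = 2 * sin ((a + b + c) / 2) * sin ((b + c - a) / 2)"
    using cos_diff_cos[of a "b + c"] by (simp add: add.assoc)
  have m: "cos (b - c) - cos a = 2 * sin ((a + b - c) / 2) * sin ((c + a - b) / 2)"
    using cos_diff_cos[of "b - c" a] by (simp add: algebra_simps)
  have "(cos (b - c) - cos a) * (cos a - cos (b + c)) =
      (sin b)\<^sup>2 * (sin c)\<^sup>2 - (cos a - cos b * cos c)\<^sup>2"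
    by (simp add: cos_add cos_diff power2_eq_square algebra_simps)
  also have "\<dots> = 1 + 2 * cos a * cos b * cos c - (cos a)\<^sup>2 - (cos b)\<^sup>2 - (cos c)\<^sup>2"
    unfolding sin_squared_eq by (simp add: power2_eq_square algebra_simps)
  finally show ?thesis unfolding p m by (simp add: algebra_simps)
qed

text \<open>Under the weak inequalities all four half-angles lie in the interval from 0 to
  \<open>pi\<close>, where the sine is positive except at the two ends. An end is reached exactly
  when one of the inequalities is an equality.\<close>

lemma gram_det_pos_iff:
  fixes a b c :: real
  assumes "a \<in> {0<..<pi}" "b \<in> {0<..<pi}" "c \<in> {0<..<pi}"
    and "a \<le> b + c" "b \<le> c + a" "c \<le> a + b" "a + b + c \<le> 2 * pi"
  shows "0 < 1 + 2 * cos a * cos b * cos c - (cos a)\<^sup>2 - (cos b)\<^sup>2 - (cos c)\<^sup>2 \<longleftrightarrow>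
    a < b + c \<and> b < c + a \<and> c < a + b \<and> a + b + c < 2 * pi"
    (is "0 < ?d \<longleftrightarrow> _")
proof
  assume "a < b + c \<and> b < c + a \<and> c < a + b \<and> a + b + c < 2 * pi"
  then show "0 < ?d"
    unfolding spherical_gram_det using assms by (intro mult_pos_pos sin_gt_zero) auto
next
  assume "0 < ?d"
  then have "sin ((a + b + c) / 2) \<noteq> 0" "sin ((b + c - a) / 2) \<noteq> 0"
    "sin ((c + a - b) / 2) \<noteq> 0" "sin ((a + b - c) / 2) \<noteq> 0"
    unfolding spherical_gram_det by auto
  then have "a + b + c \<noteq> 2 * pi" "b + c - a \<noteq> 0" "c + a - b \<noteq> 0" "a + b - c \<noteq> 0"
    by auto
  then show "a < b + c \<and> b < c + a \<and> c < a + b \<and> a + b + c < 2 * pi"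
    using assms by linarith
qed

text \<open>Put \<open>x\<close> on the first axis and \<open>y\<close> in the plane of the first
  two. The products with \<open>x\<close> and \<open>y\<close> then force the first two coordinates
  of \<open>z\<close>, and its squared height is the Gram determinant divided by
  \<open>(sin a)\<^sup>2\<close>.\<close>

lemma spherical_triangle_exists:
  fixes a b c :: real
  assumes "a \<in> {0<..<pi}"
    and det: "0 < 1 + 2 * cos a * cos b * cos c - (cos a)\<^sup>2 - (cos b)\<^sup>2 - (cos c)\<^sup>2"
  obtains x y z :: "real^3" where
    "x \<bullet> x = 1" "y \<bullet> y = 1" "z \<bullet> z = 1" "x \<bullet> y = cos a" "y \<bullet> z = cos b" "z \<bullet> x = cos c"
proof -
  have s: "sin a > 0" using assms by (simp add: sin_gt_zero)
  define p where "p = (cos b - cos a * cos c) / sin a"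
  have sp: "sin a * p = cos b - cos a * cos c" using s by (simp add: p_def)
  have "(sin a)\<^sup>2 * (1 - (cos c)\<^sup>2 - p\<^sup>2) = (sin a)\<^sup>2 * (1 - (cos c)\<^sup>2) - (sin a * p)\<^sup>2"
    by (simp add: algebra_simps)
  also have "\<dots> = 1 + 2 * cos a * cos b * cos c - (cos a)\<^sup>2 - (cos b)\<^sup>2 - (cos c)\<^sup>2"
    unfolding sp sin_squared_eq by (simp add: power2_eq_square algebra_simps)
  finally have "0 < 1 - (cos c)\<^sup>2 - p\<^sup>2"
    using det s by (metis zero_less_mult_pos zero_less_power)
  then have r: "(sqrt (1 - (cos c)\<^sup>2 - p\<^sup>2))\<^sup>2 = 1 - (cos c)\<^sup>2 - p\<^sup>2" by simp
  show thesis
  proof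
    let ?x = "vector [1, 0, 0] :: real^3" and ?y = "vector [cos a, sin a, 0] :: real^3"
      and ?z = "vector [cos c, p, sqrt (1 - (cos c)\<^sup>2 - p\<^sup>2)] :: real^3"
    show "?x \<bullet> ?x = 1" "?x \<bullet> ?y = cos a" "?z \<bullet> ?x = cos c"
      by (simp_all add: inner_vec_def sum_3)
    show "?y \<bullet> ?y = 1" by (simp add: inner_vec_def sum_3 flip: power2_eq_square)
    show "?z \<bullet> ?z = 1" using r by (simp add: inner_vec_def sum_3 flip: power2_eq_square)
    show "?y \<bullet> ?z = cos b" using sp by (simp add: inner_vec_def sum_3)
  qed
qed

section \<open>Derivatives of the Lagrangian\<close>

lemma frechet_derivative_lagrangian_velocity:
  "frechet_derivative (\<lambda>v. lagrangian m U x v) (at v) w =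
     m $ 1 * (v $ 1 \<bullet> w $ 1) + m $ 2 * (v $ 2 \<bullet> w $ 2) + m $ 3 * (v $ 3 \<bullet> w $ 3)"
proof -
  have "((\<lambda>v. lagrangian m U x v) has_derivative
     (\<lambda>w. m $ 1 * (v $ 1 \<bullet> w $ 1) + m $ 2 * (v $ 2 \<bullet> w $ 2) + m $ 3 * (v $ 3 \<bullet> w $ 3))) (at v)"
    unfolding lagrangian_expand
    by (rule derivative_eq_intros bounded_linear.has_derivative[OF bounded_linear_vec_nth] refl)+
       (simp add: fun_eq_iff inner_commute algebra_simps)
  then show ?thesis by (simp add: frechet_derivative_at[symmetric])
qed

lemma frechet_derivative_lagrangian_position:
  assumes "(U has_real_derivative u12) (at (x $ 1 \<bullet> x $ 2))"
    and "(U has_real_derivative u23) (at (x $ 2 \<bullet> x $ 3))"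
    and "(U has_real_derivative u31) (at (x $ 3 \<bullet> x $ 1))"
  shows "frechet_derivative (\<lambda>x. lagrangian m U x v) (at x) w =
     m $ 1 * m $ 2 * u12 * (x $ 1 \<bullet> w $ 2 + w $ 1 \<bullet> x $ 2) +
     m $ 2 * m $ 3 * u23 * (x $ 2 \<bullet> w $ 3 + w $ 2 \<bullet> x $ 3) +
     m $ 3 * m $ 1 * u31 * (x $ 3 \<bullet> w $ 1 + w $ 3 \<bullet> x $ 1)"
proof -
  \<comment> \<open>Chain rule for one pair potential, using differentiability of \<open>U\<close>
    only at the inner product in question.\<close>
  have U: "((\<lambda>x. U (x $ i \<bullet> x $ j)) has_derivative (\<lambda>w. u * (x $ i \<bullet> w $ j + w $ i \<bullet> x $ j))) (at x)"
    if "(U has_real_derivative u) (at (x $ i \<bullet> x $ j))" for i j u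
    by (rule has_derivative_compose[where g = U and f = "\<lambda>x. x $ i \<bullet> x $ j",
          OF has_derivative_inner[OF bounded_linear_imp_has_derivative[OF bounded_linear_vec_nth]
               bounded_linear_imp_has_derivative[OF bounded_linear_vec_nth]]
             that[unfolded has_field_derivative_def]])
  have "((\<lambda>x. lagrangian m U x v) has_derivative (\<lambda>w.
     m $ 1 * m $ 2 * u12 * (x $ 1 \<bullet> w $ 2 + w $ 1 \<bullet> x $ 2) +
     m $ 2 * m $ 3 * u23 * (x $ 2 \<bullet> w $ 3 + w $ 2 \<bullet> x $ 3) +
     m $ 3 * m $ 1 * u31 * (x $ 3 \<bullet> w $ 1 + w $ 3 \<bullet> x $ 1))) (at x)"
    unfolding lagrangian_expand
    by (rule derivative_eq_intros U assms refl)+ (simp add: fun_eq_iff algebra_simps)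
  then show ?thesis by (simp add: frechet_derivative_at[symmetric])
qed

lemma has_vector_derivative_componentwise:
  fixes q :: "real \<Rightarrow> 'a::euclidean_space^'n"
  assumes "\<And>k. ((\<lambda>s. q s $ k) has_vector_derivative d $ k) (at t)"
  shows "(q has_vector_derivative d) (at t)"
  unfolding has_vector_derivative_def has_derivative_componentwise_within[of q]
proof
  fix b :: "'a^'n" assume "b \<in> Basis"
  then obtain k u where b: "b = axis k u" by (auto simp: Basis_vec_def)
  have "((\<lambda>s. q s $ k \<bullet> u) has_derivative (\<lambda>h. (h *\<^sub>R d $ k) \<bullet> u)) (at t)"
    using assms[of k] unfolding has_vector_derivative_def by (rule has_derivative_inner_left)
  then show "((\<lambda>s. q s \<bullet> b) has_derivative (\<lambda>h. (h *\<^sub>R d) \<bullet> b)) (at t)"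
    by (simp add: b inner_axis)
qed

section \<open>Rotation with constant angular velocity and its equations of motion\<close>

lemma cross3_cross3_self:
  "cross3 \<Omega> (cross3 \<Omega> x) = (\<Omega> \<bullet> x) *\<^sub>R \<Omega> - (\<Omega> \<bullet> \<Omega>) *\<^sub>R x"
  by (simp add: cross3_simps forall_3)

lemma inner_cross3_skew: "cross3 \<Omega> x \<bullet> y + x \<bullet> cross3 \<Omega> y = 0"
  by (simp add: cross3_simps)

lemma has_vector_derivative_cross3:
  assumes "(f has_vector_derivative d) F"
  shows "((\<lambda>s. cross3 \<Omega> (f s)) has_vector_derivative cross3 \<Omega> d) F"
proof (rule bounded_linear.has_vector_derivative[OF _ assms])
  show "bounded_linear (cross3 \<Omega>)"
    using bilinear_cross by (auto simp: bilinear_def linear_conv_bounded_linear)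
qed

text \<open>Rodrigues' formula with angular velocity \<open>\<Omega>\<close>; for \<open>\<Omega> = 0\<close> division by zero gives the identity.\<close>
definition rotation_about :: "real^3 \<Rightarrow> real \<Rightarrow> real^3 \<Rightarrow> real^3" where
  "rotation_about \<Omega> t x = cos (norm \<Omega> * t) *\<^sub>R x + (sin (norm \<Omega> * t) / norm \<Omega>) *\<^sub>R cross3 \<Omega> x
     + ((1 - cos (norm \<Omega> * t)) / (norm \<Omega>)\<^sup>2 * (\<Omega> \<bullet> x)) *\<^sub>R \<Omega>"

lemma rotation_about_0 [simp]: "rotation_about \<Omega> 0 x = x"
  by (simp add: rotation_about_def)

lemma rotation_about_axis: "\<Omega> \<noteq> 0 \<Longrightarrow> rotation_about \<Omega> t \<Omega> = \<Omega>"
  by (simp add: rotation_about_def dot_square_norm flip: scaleR_add_left)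

lemma rotation_about_add: "rotation_about \<Omega> t (x + y) = rotation_about \<Omega> t x + rotation_about \<Omega> t y"
  by (simp add: rotation_about_def cross_add_right inner_add_right scaleR_add_right scaleR_add_left
      distrib_left)

lemma rotation_about_scaleR: "rotation_about \<Omega> t (c *\<^sub>R x) = c *\<^sub>R rotation_about \<Omega> t x"
  by (simp add: rotation_about_def cross_mult_right scaleR_add_right mult_ac)

lemma rotation_about_has_vector_derivative:
  assumes "\<Omega> \<noteq> 0"
  shows "((\<lambda>s. rotation_about \<Omega> s x) has_vector_derivative cross3 \<Omega> (rotation_about \<Omega> t x)) (at t)"
proof -
  let ?w = "norm \<Omega>"
  have w: "?w \<noteq> 0" using assms by simp
  have "((\<lambda>s. rotation_about \<Omega> s x) has_vector_derivative
      (- ?w * sin (?w * t)) *\<^sub>R x + cos (?w * t) *\<^sub>R cross3 \<Omega> x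
      + (sin (?w * t) / ?w * (\<Omega> \<bullet> x)) *\<^sub>R \<Omega>) (at t)"
    unfolding rotation_about_def using w
    by (auto intro!: derivative_eq_intros simp: field_simps power2_eq_square)
  \<comment> \<open>\<open>cross3 \<Omega>\<close> kills the term along the axis, and the double
    cross product supplies the two sine terms.\<close>
  also have "(- ?w * sin (?w * t)) *\<^sub>R x + cos (?w * t) *\<^sub>R cross3 \<Omega> x
      + (sin (?w * t) / ?w * (\<Omega> \<bullet> x)) *\<^sub>R \<Omega> = cross3 \<Omega> (rotation_about \<Omega> t x)"
    unfolding rotation_about_def cross_add_right cross_mult_right cross3_cross3_self
    using w by (simp add: dot_square_norm scaleR_diff_right power2_eq_square)
  finally show ?thesis .
qed

text \<open>The derivative of the inner product vanishes because \<open>cross3 \<Omega>\<close> is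
  skew. Taking the constant function \<Omega> for \<open>f\<close> also gives conservation of the
  component along the axis.\<close>

lemma inner_constant_of_rotating:
  fixes f g :: "real \<Rightarrow> real^3"
  assumes "\<And>t. (f has_vector_derivative cross3 \<Omega> (f t)) (at t)"
    and "\<And>t. (g has_vector_derivative cross3 \<Omega> (g t)) (at t)"
  shows "f t \<bullet> g t = f 0 \<bullet> g 0"
proof -
  have "((\<lambda>s. f s \<bullet> g s) has_real_derivative 0) (at t)" for t
  proof -
    have "((\<lambda>s. f s \<bullet> g s) has_derivative
        (\<lambda>h. f t \<bullet> (h *\<^sub>R cross3 \<Omega> (g t)) + (h *\<^sub>R cross3 \<Omega> (f t)) \<bullet> g t)) (at t)"
      using assms[of t] unfolding has_vector_derivative_def by (rule has_derivative_inner)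
    moreover have "f t \<bullet> (h *\<^sub>R cross3 \<Omega> (g t)) + (h *\<^sub>R cross3 \<Omega> (f t)) \<bullet> g t = 0 * h" for h
      using inner_cross3_skew[of \<Omega> "f t" "g t"] by (simp add: add.commute flip: distrib_left)
    ultimately show ?thesis by (simp only: has_field_derivative_def)
  qed
  then show ?thesis using DERIV_isconst_all[of "\<lambda>s. f s \<bullet> g s" t 0] by blast
qed

text \<open>The momentum side has derivative \<open>?A t w\<close> by direct computation, so
  uniqueness of derivatives turns the Euler-Lagrange condition into the equality of
  \<open>?A t w\<close> with the force term \<open>?F t w\<close>.\<close>

lemma euler_lagrange_rotating_iff:
  assumes sphere: "\<And>t k. q t $ k \<bullet> q t $ k = 1"
    and deriv: "\<And>t k. ((\<lambda>s. q s $ k) has_vector_derivative cross3 \<Omega> (q t $ k)) (at t)"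
    and U: "(U has_real_derivative u12) (at c12)" "(U has_real_derivative u23) (at c23)"
      "(U has_real_derivative u31) (at c31)"
    and c: "\<And>t. q t $ 1 \<bullet> q t $ 2 = c12" "\<And>t. q t $ 2 \<bullet> q t $ 3 = c23"
      "\<And>t. q t $ 3 \<bullet> q t $ 1 = c31"
  shows "euler_lagrange_on_spheres (lagrangian m U) q \<longleftrightarrow>
    (\<forall>t w. (\<forall>k. w $ k \<bullet> q t $ k = 0) \<longrightarrow>
      m $ 1 * ((\<Omega> \<bullet> q t $ 1) * (\<Omega> \<bullet> w $ 1)) + m $ 2 * ((\<Omega> \<bullet> q t $ 2) * (\<Omega> \<bullet> w $ 2))
        + m $ 3 * ((\<Omega> \<bullet> q t $ 3) * (\<Omega> \<bullet> w $ 3)) =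
      m $ 1 * m $ 2 * u12 * (q t $ 1 \<bullet> w $ 2 + w $ 1 \<bullet> q t $ 2) +
      m $ 2 * m $ 3 * u23 * (q t $ 2 \<bullet> w $ 3 + w $ 2 \<bullet> q t $ 3) +
      m $ 3 * m $ 1 * u31 * (q t $ 3 \<bullet> w $ 1 + w $ 3 \<bullet> q t $ 1))"
    (is "_ \<longleftrightarrow> (\<forall>t w. ?tangent t w \<longrightarrow> ?A t w = ?F t w)")
proof -
  have q': "(q has_vector_derivative (\<chi> k. cross3 \<Omega> (q t $ k))) (at t)" for t
    by (rule has_vector_derivative_componentwise) (simp add: deriv)
  have vd: "vector_derivative q (at t) = (\<chi> k. cross3 \<Omega> (q t $ k))" for t
    using q' by (rule vector_derivative_at)
  have F: "frechet_derivative (\<lambda>x. lagrangian m U x v) (at (q t)) w = ?F t w" for t v w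
    by (rule frechet_derivative_lagrangian_position) (simp_all add: U c)
  have A: "((\<lambda>s. frechet_derivative (\<lambda>v. lagrangian m U (q s) v)
      (at (vector_derivative q (at s))) w) has_real_derivative ?A t w) (at t)"
    if w: "?tangent t w" for t w
  proof -
    \<comment> \<open>The vector \<open>w\<close> stays fixed as \<open>s\<close> varies and is
      assumed tangent only at time \<open>t\<close>. That suffices: the derivative is taken at
      \<open>t\<close>, where the part of the acceleration along \<open>q t $ k\<close> drops
      out.\<close>
    have k: "((\<lambda>s. cross3 \<Omega> (q s $ k) \<bullet> w $ k) has_real_derivative
        (\<Omega> \<bullet> q t $ k) * (\<Omega> \<bullet> w $ k)) (at t)" for k
    proof -
      have "((\<lambda>s. cross3 \<Omega> (q s $ k) \<bullet> w $ k) has_derivative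
          (\<lambda>h. (h *\<^sub>R cross3 \<Omega> (cross3 \<Omega> (q t $ k))) \<bullet> w $ k)) (at t)"
        using has_vector_derivative_cross3[OF deriv] unfolding has_vector_derivative_def
        by (rule has_derivative_inner_left)
      also have "(\<lambda>h. (h *\<^sub>R cross3 \<Omega> (cross3 \<Omega> (q t $ k))) \<bullet> w $ k) =
          (*) ((\<Omega> \<bullet> q t $ k) * (\<Omega> \<bullet> w $ k))"
        using w by (simp add: fun_eq_iff cross3_cross3_self inner_diff_left
            inner_commute[of "q t $ k"])
      finally show ?thesis unfolding has_field_derivative_def .
    qed
    show ?thesis
      unfolding frechet_derivative_lagrangian_velocity vd vec_lambda_beta
      by (intro DERIV_add DERIV_cmult k)
  qed
  have "q differentiable (at t)" for t
    using q' by (rule differentiableI_vector)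
  moreover have "q t $ k \<in> sphere 0 1" for t k
    using sphere by (simp add: norm_eq_1)
  moreover have "((\<lambda>s. frechet_derivative (\<lambda>v. lagrangian m U (q s) v)
      (at (vector_derivative q (at s))) w) has_real_derivative ?F t w) (at t) \<longleftrightarrow>
      ?A t w = ?F t w" (is "?D t w \<longleftrightarrow> _") if "?tangent t w" for t w
  proof
    assume "?A t w = ?F t w"
    with A[OF that] show "?D t w" by (simp only:)
  qed (rule DERIV_unique[OF A[OF that]])
  ultimately show ?thesis
    unfolding euler_lagrange_on_spheres_def F by (simp only: simp_thms cong: imp_cong)
qed

section \<open>The eigenvector condition and its equivalence with force balance\<close>

lemma is_eigenvector_scaleR_iff:
  assumes "c \<noteq> 0"
  shows "is_eigenvector A (c *\<^sub>R v) \<longleftrightarrow> is_eigenvector A v"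
proof -
  have "A *v (c *\<^sub>R v) = \<mu> *\<^sub>R c *\<^sub>R v \<longleftrightarrow> A *v v = \<mu> *\<^sub>R v" for \<mu>
    using assms by (simp only: matrix_vector_mult_scaleR scaleR_left_commute[of \<mu>]
        scaleR_cancel_left simp_thms)
  then show ?thesis using assms by (simp add: is_eigenvector_def)
qed

text \<open>The normalising factor is nonzero and may be dropped, and row \<open>k\<close> can be
  divided by \<open>sqrt (m $ k)\<close>. Since \<open>J_matrix\<close> is the total mass times the
  identity minus a weighted Gram matrix, an eigenvalue \<mu> corresponds to \<nu> being the total
  mass minus \<mu>.\<close>

lemma is_eigenvector_J_Psi_iff:
  assumes m: "\<And>k. 0 < m $ k"
    and sym: "\<And>i j. \<sigma> i j = \<sigma> j i"
    and u: "U' (cos (\<sigma> 1 2)) = u12" "U' (cos (\<sigma> 2 3)) = u23" "U' (cos (\<sigma> 3 1)) = u31"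
    and u0: "u12 \<noteq> 0" "u23 \<noteq> 0" "u31 \<noteq> 0"
  shows "is_eigenvector (J_matrix m \<sigma>) (Psi_L m U' \<sigma>) \<longleftrightarrow>
    (\<exists>\<nu>. m $ 1 / u23 + m $ 2 / u31 * cos (\<sigma> 1 2) + m $ 3 / u12 * cos (\<sigma> 3 1) = \<nu> / u23 \<and>
         m $ 1 / u23 * cos (\<sigma> 1 2) + m $ 2 / u31 + m $ 3 / u12 * cos (\<sigma> 2 3) = \<nu> / u31 \<and>
         m $ 1 / u23 * cos (\<sigma> 3 1) + m $ 2 / u31 * cos (\<sigma> 2 3) + m $ 3 / u12 = \<nu> / u12)"
    (is "_ \<longleftrightarrow> (\<exists>\<nu>. ?E \<nu>)")
proof -
  let ?M = "m $ 1 + m $ 2 + m $ 3"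
  let ?v = "vector [sqrt (m $ 1) / u23, sqrt (m $ 2) / u31, sqrt (m $ 3) / u12] :: real^3"
  have "0 < m $ 3 / u12\<^sup>2 + m $ 1 / u23\<^sup>2 + m $ 2 / u31\<^sup>2"
    using m u0 by (intro add_pos_pos divide_pos_pos) auto
  then have 1: "is_eigenvector (J_matrix m \<sigma>) (Psi_L m U' \<sigma>) \<longleftrightarrow> is_eigenvector (J_matrix m \<sigma>) ?v"
    unfolding Psi_L_def u by (intro is_eigenvector_scaleR_iff) simp
  have "?v \<noteq> 0"
    using m[of 1] u0 by (simp add: vec_eq_iff forall_3)
  have r: "sqrt (m $ k) \<noteq> 0" for k
    using m[of k] by simp
  have g: "sqrt (m $ i * m $ j) * t * (sqrt (m $ j) / u) = sqrt (m $ i) * (m $ j / u * t)" for i j t u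
    using m[of j] by (simp add: real_sqrt_mult)
  have J: "(J_matrix m \<sigma> *v ?v) $ 1 =
      sqrt (m $ 1) * (?M / u23 - (m $ 1 / u23 + m $ 2 / u31 * cos (\<sigma> 1 2) + m $ 3 / u12 * cos (\<sigma> 3 1)))"
    "(J_matrix m \<sigma> *v ?v) $ 2 =
      sqrt (m $ 2) * (?M / u31 - (m $ 1 / u23 * cos (\<sigma> 1 2) + m $ 2 / u31 + m $ 3 / u12 * cos (\<sigma> 2 3)))"
    "(J_matrix m \<sigma> *v ?v) $ 3 =
      sqrt (m $ 3) * (?M / u12 - (m $ 1 / u23 * cos (\<sigma> 3 1) + m $ 2 / u31 * cos (\<sigma> 2 3) + m $ 3 / u12))"
    unfolding J_matrix_def matrix_vector_mult_def sum_3 vec_lambda_beta vector_3 if_True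
      three_neq[THEN if_not_P] minus_mult_left[symmetric] g sym[of 2 1] sym[of 3 2] sym[of 1 3]
    by (simp_all add: add_divide_distrib algebra_simps)
  have E: "J_matrix m \<sigma> *v ?v = \<mu> *\<^sub>R ?v \<longleftrightarrow> ?E (?M - \<mu>)" for \<mu>
  proof -
    have "sqrt (m $ k) * (?M / u - L) = \<mu> * (sqrt (m $ k) / u) \<longleftrightarrow> L = (?M - \<mu>) / u" for k u L
    proof -
      have "\<mu> * (sqrt (m $ k) / u) = sqrt (m $ k) * (\<mu> / u)" by simp
      then show ?thesis
        using r[of k] by (auto simp only: mult_cancel_left diff_divide_distrib)
    qed
    then show ?thesis
      by (simp only: vec_eq_iff forall_3 J vector_scaleR_component vector_3 real_scaleR_def)
  qed
  have "(\<exists>\<mu>. ?E (?M - \<mu>)) \<longleftrightarrow> (\<exists>\<nu>. ?E \<nu>)"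
  proof (intro iffI; elim exE)
    fix \<nu> assume "?E \<nu>"
    then have "?E (?M - (?M - \<nu>))" by (simp only: diff_diff_eq2 add_diff_cancel_left')
    then show "\<exists>\<mu>. ?E (?M - \<mu>)" ..
  next
    fix \<mu> assume "?E (?M - \<mu>)"
    then show "\<exists>\<nu>. ?E \<nu>" ..
  qed
  then show ?thesis
    unfolding 1 unfolding is_eigenvector_def E using \<open>?v \<noteq> 0\<close> by (simp only: not_False_eq_True simp_thms)
qed

lemma force_balance_imp_eigenvalue_equation:
  fixes x y z \<Omega> :: "real^3" and u12 u23 u31 :: real
  assumes m: "0 < m1" "0 < m2" "0 < m3"
    and u0: "u12 \<noteq> 0" "u23 \<noteq> 0" "u31 \<noteq> 0"
    and unit: "x \<bullet> x = 1" "y \<bullet> y = 1" "z \<bullet> z = 1"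
    and triple: "x \<bullet> cross3 y z \<noteq> 0"
    and bal_x: "\<And>w. w \<bullet> x = 0 \<Longrightarrow> (\<Omega> \<bullet> x) * (\<Omega> \<bullet> w) = m2 * u12 * (y \<bullet> w) + m3 * u31 * (z \<bullet> w)"
    and bal_y: "\<And>w. w \<bullet> y = 0 \<Longrightarrow> (\<Omega> \<bullet> y) * (\<Omega> \<bullet> w) = m1 * u12 * (x \<bullet> w) + m3 * u23 * (z \<bullet> w)"
    and bal_z: "\<And>w. w \<bullet> z = 0 \<Longrightarrow> (\<Omega> \<bullet> z) * (\<Omega> \<bullet> w) = m1 * u31 * (x \<bullet> w) + m2 * u23 * (y \<bullet> w)"
  shows "0 < u12 * u23 * u31 \<and>
    (\<exists>\<nu>. m1 / u23 + m2 / u31 * (x \<bullet> y) + m3 / u12 * (z \<bullet> x) = \<nu> / u23 \<and>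
         m1 / u23 * (x \<bullet> y) + m2 / u31 + m3 / u12 * (y \<bullet> z) = \<nu> / u31 \<and>
         m1 / u23 * (z \<bullet> x) + m2 / u31 * (y \<bullet> z) + m3 / u12 = \<nu> / u12)"
proof -
  define T where "T = x \<bullet> cross3 y z"
  have T0: "T \<noteq> 0" using triple by (simp add: T_def)
  define a b c where "a = (\<Omega> \<bullet> cross3 y z) / T" and "b = (\<Omega> \<bullet> cross3 z x) / T"
    and "c = (\<Omega> \<bullet> cross3 x y) / T"
  define p q r where "p = \<Omega> \<bullet> x" and "q = \<Omega> \<bullet> y" and "r = \<Omega> \<bullet> z"
  have T: "y \<bullet> cross3 z x = T" "z \<bullet> cross3 x y = T" "y \<bullet> cross3 x z = - T" "z \<bullet> cross3 y x = - T"
      "x \<bullet> cross3 z y = - T"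
    unfolding T_def by (simp_all add: cross3_simps)
  have "\<Omega> = (1 / T) *\<^sub>R (T *\<^sub>R \<Omega>)" using T0 by simp
  also have "\<dots> = a *\<^sub>R x + b *\<^sub>R y + c *\<^sub>R z"
    unfolding T_def triple_scaleR_expansion[of x y z] scaleR_add_right
    by (simp add: a_def b_def c_def T_def)
  finally have \<Omega>: "\<Omega> = a *\<^sub>R x + b *\<^sub>R y + c *\<^sub>R z" .
  have pqr: "p = a + b * (x \<bullet> y) + c * (z \<bullet> x)" "q = a * (x \<bullet> y) + b + c * (y \<bullet> z)"
      "r = a * (z \<bullet> x) + b * (y \<bullet> z) + c"
    unfolding p_def q_def r_def \<Omega> inner_add_left inner_scaleR_left
    by (simp_all add: unit inner_commute)
  \<comment> \<open>\<open>cross3 x y\<close> is tangent at both \<open>x\<close> and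
    \<open>y\<close>. Inserted in either balance it leaves only the force from \<open>z\<close> and,
    on the left, only the coefficient \<open>c\<close>. The other two cross products act
    likewise.\<close>
  have pc: "p * c = m3 * u31" and qc: "q * c = m3 * u23"
    using bal_x[of "cross3 x y"] bal_y[of "cross3 x y"] T0
    by (simp_all add: c_def p_def q_def T dot_cross_self field_simps)
  have pb: "p * b = m2 * u12" and rb: "r * b = m2 * u23"
    using bal_x[of "cross3 z x"] bal_z[of "cross3 z x"] T0
    by (simp_all add: b_def p_def r_def T dot_cross_self field_simps)
  have qa: "q * a = m1 * u12" and ra: "r * a = m1 * u31"
    using bal_y[of "cross3 y z"] bal_z[of "cross3 y z"] T0 T_def
    by (simp_all add: a_def q_def r_def dot_cross_self field_simps)
  have nz: "p \<noteq> 0" "q \<noteq> 0" "r \<noteq> 0" "a \<noteq> 0"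
    using pc qc ra u0 m by auto
  \<comment> \<open>The common ratio: \<open>b\<close> and \<open>c\<close> turn out to be the same
    multiple of \<open>m2 * q\<close> and \<open>m3 * r\<close>.\<close>
  define l where "l = a / (m1 * p)"
  have l0: "l \<noteq> 0" using nz m by (simp add: l_def)
  have a: "a = l * m1 * p" using nz m by (simp add: l_def)
  have "q * l * p = u12" using qa m unfolding a by simp
  have "r * l * p = u31" using ra m unfolding a by simp
  have b: "b = l * m2 * q"
    using pb nz unfolding \<open>q * l * p = u12\<close>[symmetric] by (simp add: algebra_simps)
  have c: "c = l * m3 * r"
    using pc nz unfolding \<open>r * l * p = u31\<close>[symmetric] by (simp add: algebra_simps)
  have "q * l * r = u23" using qc m unfolding c by simp
  note u = \<open>q * l * p = u12\<close>[symmetric] \<open>r * l * p = u31\<close>[symmetric] this[symmetric]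
  have "\<Omega> \<noteq> 0" using nz by (auto simp: p_def)
  then have "0 < \<Omega> \<bullet> \<Omega>" by simp
  also have "\<Omega> \<bullet> \<Omega> = a * p + b * q + c * r"
    unfolding p_def q_def r_def by (subst (2) \<Omega>) (simp add: inner_add_right)
  also have "\<dots> = l * (m1 * p\<^sup>2 + m2 * q\<^sup>2 + m3 * r\<^sup>2)"
    by (simp add: a b c power2_eq_square algebra_simps)
  finally have "0 < l * (m1 * p\<^sup>2 + m2 * q\<^sup>2 + m3 * r\<^sup>2)" .
  moreover have "0 \<le> m1 * p\<^sup>2 + m2 * q\<^sup>2 + m3 * r\<^sup>2" using m by simp
  ultimately have "0 < l" by (simp add: zero_less_mult_iff)
  \<comment> \<open>Each of \<open>p\<close>, \<open>q\<close>, \<open>r\<close> occurs in two of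
    the three factors, so the sign of the product is that of \<open>l\<close>.\<close>
  moreover have "u12 * u23 * u31 = l ^ 3 * (p * q * r)\<^sup>2"
    unfolding u by (simp add: power2_eq_square power3_eq_cube)
  ultimately have pos: "0 < u12 * u23 * u31" using nz by simp
  \<comment> \<open>Over one common denominator the three equations become \<open>pqr\<close>, with
    \<nu> equal to \<open>1 / l\<close>.\<close>
  have d: "m1 / u23 = a / (l * (l * p * q * r))" "m2 / u31 = b / (l * (l * p * q * r))"
    "m3 / u12 = c / (l * (l * p * q * r))" "1 / l / u23 = p / (l * (l * p * q * r))"
    "1 / l / u31 = q / (l * (l * p * q * r))" "1 / l / u12 = r / (l * (l * p * q * r))"
    unfolding a b c u using nz l0 by (simp_all add: field_simps)
  have "m1 / u23 + m2 / u31 * (x \<bullet> y) + m3 / u12 * (z \<bullet> x) = 1 / l / u23"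
    "m1 / u23 * (x \<bullet> y) + m2 / u31 + m3 / u12 * (y \<bullet> z) = 1 / l / u31"
    "m1 / u23 * (z \<bullet> x) + m2 / u31 * (y \<bullet> z) + m3 / u12 = 1 / l / u12"
    unfolding d by (simp_all only: pqr add_divide_distrib times_divide_eq_left)
  with pos show ?thesis by blast
qed

text \<open>The eigenvector fixes the direction \<open>v\<close> of the axis, and the equations give
  its inner products with the bodies. Only the angular speed remains to be chosen.\<close>

lemma eigenvalue_equation_imp_force_balance:
  fixes x y z :: "real^3" and u12 u23 u31 :: real
  assumes m: "0 < m1" "0 < m2" "0 < m3"
    and u: "0 < u12" "0 < u23" "0 < u31"
    and unit: "x \<bullet> x = 1" "y \<bullet> y = 1" "z \<bullet> z = 1"
    and triple: "x \<bullet> cross3 y z \<noteq> 0"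
    and eq: "m1 / u23 + m2 / u31 * (x \<bullet> y) + m3 / u12 * (z \<bullet> x) = \<nu> / u23"
         "m1 / u23 * (x \<bullet> y) + m2 / u31 + m3 / u12 * (y \<bullet> z) = \<nu> / u31"
         "m1 / u23 * (z \<bullet> x) + m2 / u31 * (y \<bullet> z) + m3 / u12 = \<nu> / u12"
  obtains \<Omega> a b c where "\<Omega> \<noteq> 0" "\<Omega> = a *\<^sub>R x + b *\<^sub>R y + c *\<^sub>R z"
    "(\<Omega> \<bullet> x) * b = m2 * u12" "(\<Omega> \<bullet> x) * c = m3 * u31"
    "(\<Omega> \<bullet> y) * a = m1 * u12" "(\<Omega> \<bullet> y) * c = m3 * u23"
    "(\<Omega> \<bullet> z) * a = m1 * u31" "(\<Omega> \<bullet> z) * b = m2 * u23"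
proof -
  define v where "v = (m1 / u23) *\<^sub>R x + (m2 / u31) *\<^sub>R y + (m3 / u12) *\<^sub>R z"
  have v: "v \<bullet> x = \<nu> / u23" "v \<bullet> y = \<nu> / u31" "v \<bullet> z = \<nu> / u12"
    using eq unfolding v_def inner_add_left inner_scaleR_left
    by (simp_all add: unit inner_commute)
  have "v \<bullet> cross3 y z = (m1 / u23) * (x \<bullet> cross3 y z)"
    by (simp add: v_def inner_add_left dot_cross_self)
  then have "v \<noteq> 0" using triple m u by auto
  \<comment> \<open>Expanding the squared length of \<open>v\<close> shows that \<nu> is positive,
    so the square root defining \<open>s\<close> is a real one.\<close>
  then have "0 < v \<bullet> v" by simp
  also have "v \<bullet> v = m1 / u23 * (v \<bullet> x) + m2 / u31 * (v \<bullet> y) + m3 / u12 * (v \<bullet> z)"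
    by (subst (2) v_def) (simp add: inner_add_right)
  also have "\<dots> = \<nu> * (m1 / u23\<^sup>2 + m2 / u31\<^sup>2 + m3 / u12\<^sup>2)"
    by (simp add: v power2_eq_square algebra_simps)
  finally have "0 < \<nu> * (m1 / u23\<^sup>2 + m2 / u31\<^sup>2 + m3 / u12\<^sup>2)" .
  moreover have "0 \<le> m1 / u23\<^sup>2 + m2 / u31\<^sup>2 + m3 / u12\<^sup>2" using m by simp
  ultimately have \<nu>: "0 < \<nu>" by (simp add: zero_less_mult_iff)
  \<comment> \<open>Each balance is quadratic in the scale. For instance
    \<open>s * (\<nu> / u23) * (s * (m2 / u31))\<close> must equal \<open>m2 * u12\<close>, which
    dictates \<open>s * s\<close>.\<close>
  define s where "s = sqrt (u12 * u23 * u31 / \<nu>)"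
  have s0: "s \<noteq> 0" using u \<nu> by (simp add: s_def)
  have "s * s = u12 * u23 * u31 / \<nu>" using u \<nu> by (simp add: s_def)
  then have s: "s * \<alpha> * (s * \<beta>) = u12 * u23 * u31 / \<nu> * (\<alpha> * \<beta>)" for \<alpha> \<beta>
    by (metis mult.assoc mult.left_commute)
  show thesis
  proof
    show "s *\<^sub>R v \<noteq> 0" using s0 \<open>v \<noteq> 0\<close> by simp
    show "s *\<^sub>R v = (s * (m1 / u23)) *\<^sub>R x + (s * (m2 / u31)) *\<^sub>R y + (s * (m3 / u12)) *\<^sub>R z"
      by (simp add: v_def scaleR_add_right)
  qed (use u \<nu> in \<open>simp_all add: inner_scaleR_left v s del: times_divide_eq_right times_divide_eq_left\<close>,
      use u \<nu> in \<open>simp_all add: field_simps\<close>)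
qed

section \<open>Passage between rotating solutions and the algebraic conditions\<close>

theorem theorem5:
  fixes m :: "real^3" and \<sigma> :: "3 \<Rightarrow> 3 \<Rightarrow> real" and U U' :: "real \<Rightarrow> real"
  assumes masses: "\<And>k. 0 < m $ k"
    and U_deriv: "\<And>c. c \<in> {-1<..<1} \<Longrightarrow> (U has_real_derivative U' c) (at c)"
    and U'_continuous: "continuous_on {-1<..<1} U'"
    and U'_definite: "(\<forall>c\<in>{-1<..<1}. 0 < U' c) \<or> (\<forall>c\<in>{-1<..<1}. U' c < 0)"
    and sym: "\<And>i j. \<sigma> i j = \<sigma> j i"
    and range: "\<And>i j. i \<noteq> j \<Longrightarrow> \<sigma> i j \<in> {0<..<pi}"
    and triangle: "\<And>i j k. (i, j, k) \<in> {(1, 2, 3), (2, 3, 1), (3, 1, 2)} \<Longrightarrow> \<sigma> i j \<le> \<sigma> j k + \<sigma> k i"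
    and perimeter: "\<sigma> 1 2 + \<sigma> 2 3 + \<sigma> 3 1 \<le> 2 * pi"
  shows "forms_lagrange_relative_equilibrium m U \<sigma> \<longleftrightarrow>
           is_eigenvector (J_matrix m \<sigma>) (Psi_L m U' \<sigma>) \<and>
           (\<forall>c\<in>{-1<..<1}. 0 < U' c) \<and>
           (\<forall>(i, j, k)\<in>{(1, 2, 3), (2, 3, 1), (3, 1, 2)}. \<sigma> i j < \<sigma> j k + \<sigma> k i) \<and>
           \<sigma> 1 2 + \<sigma> 2 3 + \<sigma> 3 1 < 2 * pi"
proof -
  define u12 u23 u31 where "u12 = U' (cos (\<sigma> 1 2))" and "u23 = U' (cos (\<sigma> 2 3))"
    and "u31 = U' (cos (\<sigma> 3 1))"
  note u_def = u12_def u23_def u31_def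
  have cos_range: "cos (\<sigma> i j) \<in> {-1<..<1}" if "i \<noteq> j" for i j
    using range[OF that] cos_monotone_0_pi[of 0 "\<sigma> i j"] cos_monotone_0_pi[of "\<sigma> i j" pi] by simp
  have U: "(U has_real_derivative u12) (at (cos (\<sigma> 1 2)))"
    "(U has_real_derivative u23) (at (cos (\<sigma> 2 3)))"
    "(U has_real_derivative u31) (at (cos (\<sigma> 3 1)))"
    unfolding u_def by (intro U_deriv cos_range, simp)+
  have u0: "u12 \<noteq> 0" "u23 \<noteq> 0" "u31 \<noteq> 0"
    unfolding u_def using U'_definite cos_range by (metis three_neq less_irrefl)+
  let ?G = "1 + 2 * cos (\<sigma> 1 2) * cos (\<sigma> 2 3) * cos (\<sigma> 3 1)
    - (cos (\<sigma> 1 2))\<^sup>2 - (cos (\<sigma> 2 3))\<^sup>2 - (cos (\<sigma> 3 1))\<^sup>2"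
  \<comment> \<open>Both directions work with positivity of the Gram determinant in place of the
    strict inequalities.\<close>
  have G: "0 < ?G \<longleftrightarrow> (\<forall>(i, j, k)\<in>{(1, 2, 3), (2, 3, 1), (3, 1, 2)}. \<sigma> i j < \<sigma> j k + \<sigma> k i) \<and>
      \<sigma> 1 2 + \<sigma> 2 3 + \<sigma> 3 1 < 2 * pi"
    using gram_det_pos_iff[of "\<sigma> 1 2" "\<sigma> 2 3" "\<sigma> 3 1"] range[of 1 2] range[of 2 3] range[of 3 1]
      triangle[of 1 2 3] triangle[of 2 3 1] triangle[of 3 1 2] perimeter by auto
  note eigen = is_eigenvector_J_Psi_iff[where U' = U', OF masses sym u_def[symmetric] u0]
  have gram: "(x \<bullet> cross3 y z)\<^sup>2 = ?G" if "x \<bullet> x = 1" "y \<bullet> y = 1" "z \<bullet> z = 1"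
    "x \<bullet> y = cos (\<sigma> 1 2)" "y \<bullet> z = cos (\<sigma> 2 3)" "z \<bullet> x = cos (\<sigma> 3 1)" for x y z :: "real^3"
    using gram_det_eq_triple_square[of x y z] that by simp
  show ?thesis
    unfolding G[symmetric]
  proof safe
    assume "forms_lagrange_relative_equilibrium m U \<sigma>"
    then obtain q where lre: "lagrange_relative_equilibrium m U q"
      and arc: "\<And>t i j. i \<noteq> j \<Longrightarrow> arc_angle (q t $ i) (q t $ j) = \<sigma> i j"
      unfolding forms_lagrange_relative_equilibrium_def by blast
    then obtain \<Omega> where
      EL: "euler_lagrange_on_spheres (lagrangian m U) q"
      and deriv: "\<And>t k. ((\<lambda>s. q s $ k) has_vector_derivative cross3 \<Omega> (q t $ k)) (at t)"
      unfolding lagrange_relative_equilibrium_def relative_equilibrium_def by blast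
    have noncoplanar: "\<exists>k. q t $ k \<notin> C" if "is_great_circle C" for t C
      using lre that unfolding lagrange_relative_equilibrium_def by blast
    have sph: "norm (q t $ k) = 1" for t k
      using EL by (simp add: euler_lagrange_on_spheres_def)
    then have unit: "q t $ k \<bullet> q t $ k = 1" for t k by (simp add: norm_eq_1)
    have inner: "q t $ i \<bullet> q t $ j = cos (\<sigma> i j)" if "i \<noteq> j" for t i j
      using arc[OF that, of t] Cauchy_Schwarz_ineq2[of "q t $ i" "q t $ j"]
      by (metis arc_angle_def cos_arccos_abs mult_1 sph)
    define x y z where "x = q 0 $ 1" and "y = q 0 $ 2" and "z = q 0 $ 3"
    have xyz: "x \<bullet> x = 1" "y \<bullet> y = 1" "z \<bullet> z = 1"
      "x \<bullet> y = cos (\<sigma> 1 2)" "y \<bullet> z = cos (\<sigma> 2 3)" "z \<bullet> x = cos (\<sigma> 3 1)"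
      unfolding x_def y_def z_def by (simp_all add: unit inner)
    \<comment> \<open>Otherwise \<open>cross3 y z\<close> would be normal to a great circle through
      all three bodies. It is nonzero because \<open>y \<bullet> z\<close> is neither 1 nor
      -1.\<close>
    have triple: "x \<bullet> cross3 y z \<noteq> 0"
    proof
      assume 0: "x \<bullet> cross3 y z = 0"
      have "cross3 y z \<noteq> 0"
      proof
        assume "cross3 y z = 0"
        then have "(y \<bullet> z)\<^sup>2 = 1"
          using norm_cross_dot[of y z] xyz by (simp add: norm_eq_sqrt_inner)
        then show False using xyz cos_range[of 2 3] by (auto simp: power2_eq_1_iff)
      qed
      then have "is_great_circle {w \<in> sphere 0 1. cross3 y z \<bullet> w = 0}"
        unfolding is_great_circle_def by blast
      then obtain k where "cross3 y z \<bullet> q 0 $ k \<noteq> 0"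
        using noncoplanar[of _ 0] sph by fastforce
      moreover have "cross3 y z \<bullet> q 0 $ k = 0" for k
        using 0 exhaust_3[of k]
        by (auto simp: x_def y_def z_def dot_cross_self inner_commute)
      ultimately show False by blast
    qed
    then show "0 < ?G" using gram[OF xyz] zero_less_power2[of "x \<bullet> cross3 y z"] by simp
    have bal: "m $ 1 * ((\<Omega> \<bullet> x) * (\<Omega> \<bullet> w1)) + m $ 2 * ((\<Omega> \<bullet> y) * (\<Omega> \<bullet> w2))
        + m $ 3 * ((\<Omega> \<bullet> z) * (\<Omega> \<bullet> w3)) =
      m $ 1 * m $ 2 * u12 * (x \<bullet> w2 + w1 \<bullet> y) + m $ 2 * m $ 3 * u23 * (y \<bullet> w3 + w2 \<bullet> z) +
      m $ 3 * m $ 1 * u31 * (z \<bullet> w1 + w3 \<bullet> x)"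
      if "w1 \<bullet> x = 0" "w2 \<bullet> y = 0" "w3 \<bullet> z = 0" for w1 w2 w3
    proof -
      have "\<forall>k. vector [w1, w2, w3] $ k \<bullet> q 0 $ k = 0"
        using that by (simp add: forall_3 x_def y_def z_def)
      with EL[unfolded euler_lagrange_rotating_iff[OF unit deriv U inner inner inner, simplified],
          THEN spec[of _ 0], THEN spec[of _ "vector [w1, w2, w3]"]]
      show ?thesis by (simp only: x_def y_def z_def simp_thms vector_3)
    qed
    have m0: "m $ k \<noteq> 0" for k using masses[of k] by simp
    have "0 < u12 * u23 * u31 \<and> (\<exists>\<nu>.
        m $ 1 / u23 + m $ 2 / u31 * (x \<bullet> y) + m $ 3 / u12 * (z \<bullet> x) = \<nu> / u23 \<and>
        m $ 1 / u23 * (x \<bullet> y) + m $ 2 / u31 + m $ 3 / u12 * (y \<bullet> z) = \<nu> / u31 \<and>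
        m $ 1 / u23 * (z \<bullet> x) + m $ 2 / u31 * (y \<bullet> z) + m $ 3 / u12 = \<nu> / u12)"
    \<comment> \<open>The equation of each body comes from varying that body alone and cancelling
      its mass.\<close>
    proof (rule force_balance_imp_eigenvalue_equation[OF masses masses masses u0 xyz(1-3) triple])
      fix w
      { assume w: "w \<bullet> x = 0"
        have "m $ 1 * ((\<Omega> \<bullet> x) * (\<Omega> \<bullet> w)) =
            m $ 1 * (m $ 2 * u12 * (y \<bullet> w) + m $ 3 * u31 * (z \<bullet> w))"
          using bal[of w 0 0] w by (simp add: inner_commute algebra_simps)
        then show "(\<Omega> \<bullet> x) * (\<Omega> \<bullet> w) = m $ 2 * u12 * (y \<bullet> w) + m $ 3 * u31 * (z \<bullet> w)"
          using m0 by (metis mult_cancel_left) }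
      { assume w: "w \<bullet> y = 0"
        have "m $ 2 * ((\<Omega> \<bullet> y) * (\<Omega> \<bullet> w)) =
            m $ 2 * (m $ 1 * u12 * (x \<bullet> w) + m $ 3 * u23 * (z \<bullet> w))"
          using bal[of 0 w 0] w by (simp add: inner_commute algebra_simps)
        then show "(\<Omega> \<bullet> y) * (\<Omega> \<bullet> w) = m $ 1 * u12 * (x \<bullet> w) + m $ 3 * u23 * (z \<bullet> w)"
          using m0 by (metis mult_cancel_left) }
      { assume w: "w \<bullet> z = 0"
        have "m $ 3 * ((\<Omega> \<bullet> z) * (\<Omega> \<bullet> w)) =
            m $ 3 * (m $ 1 * u31 * (x \<bullet> w) + m $ 2 * u23 * (y \<bullet> w))"
          using bal[of 0 0 w] w by (simp add: inner_commute algebra_simps)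
        then show "(\<Omega> \<bullet> z) * (\<Omega> \<bullet> w) = m $ 1 * u31 * (x \<bullet> w) + m $ 2 * u23 * (y \<bullet> w)"
          using m0 by (metis mult_cancel_left) }
    qed
    then have pos: "0 < u12 * u23 * u31"
      and "is_eigenvector (J_matrix m \<sigma>) (Psi_L m U' \<sigma>)"
      unfolding eigen xyz by blast+
    then show "is_eigenvector (J_matrix m \<sigma>) (Psi_L m U' \<sigma>)" by blast
    \<comment> \<open>Repulsion would make the product of three negative numbers positive, so the
      definite sign of \<open>U'\<close> must be the attractive one.\<close>
    have "\<not> (u12 < 0 \<and> u23 < 0 \<and> u31 < 0)"
      using pos mult_neg_neg[of u12 u23] mult_pos_neg[of "u12 * u23" u31] by force
    then have "\<not> (\<forall>c\<in>{-1<..<1}. U' c < 0)"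
      unfolding u_def using cos_range[OF three_neq(1)] cos_range[OF three_neq(2)]
        cos_range[OF three_neq(3)] by blast
    then show "0 < U' c" if "c \<in> {-1<..<1}" for c using U'_definite that by blast
  next
    assume "is_eigenvector (J_matrix m \<sigma>) (Psi_L m U' \<sigma>)"
      and attractive: "\<forall>c\<in>{-1<..<1}. 0 < U' c" and "0 < ?G"
    obtain x y z :: "real^3" where xyz: "x \<bullet> x = 1" "y \<bullet> y = 1" "z \<bullet> z = 1"
      "x \<bullet> y = cos (\<sigma> 1 2)" "y \<bullet> z = cos (\<sigma> 2 3)" "z \<bullet> x = cos (\<sigma> 3 1)"
      using spherical_triangle_exists[OF range[OF three_neq(1)] \<open>0 < ?G\<close>] by blast
    have triple: "x \<bullet> cross3 y z \<noteq> 0" using gram[OF xyz] \<open>0 < ?G\<close> by auto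
    have u: "0 < u12" "0 < u23" "0 < u31"
      unfolding u_def using attractive cos_range by simp_all
    obtain \<nu> where \<nu>: "m $ 1 / u23 + m $ 2 / u31 * (x \<bullet> y) + m $ 3 / u12 * (z \<bullet> x) = \<nu> / u23"
      "m $ 1 / u23 * (x \<bullet> y) + m $ 2 / u31 + m $ 3 / u12 * (y \<bullet> z) = \<nu> / u31"
      "m $ 1 / u23 * (z \<bullet> x) + m $ 2 / u31 * (y \<bullet> z) + m $ 3 / u12 = \<nu> / u12"
      using \<open>is_eigenvector _ _\<close> unfolding eigen xyz by blast
    obtain \<Omega> a b c where \<Omega>0: "\<Omega> \<noteq> 0" and \<Omega>: "\<Omega> = a *\<^sub>R x + b *\<^sub>R y + c *\<^sub>R z"
      and bal: "(\<Omega> \<bullet> x) * b = m $ 2 * u12" "(\<Omega> \<bullet> x) * c = m $ 3 * u31"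
        "(\<Omega> \<bullet> y) * a = m $ 1 * u12" "(\<Omega> \<bullet> y) * c = m $ 3 * u23"
        "(\<Omega> \<bullet> z) * a = m $ 1 * u31" "(\<Omega> \<bullet> z) * b = m $ 2 * u23"
      using eigenvalue_equation_imp_force_balance[OF masses masses masses u xyz(1-3) triple \<nu>] .
    \<comment> \<open>The motion turns the triangle rigidly about \<Omega>.\<close>
    define q :: "real \<Rightarrow> real^3^3" where
      "q t = (\<chi> k. rotation_about \<Omega> t (vector [x, y, z] $ k))" for t
    have q: "q t $ k = rotation_about \<Omega> t (vector [x, y, z] $ k)" for t k
      by (simp add: q_def)
    have deriv: "((\<lambda>s. q s $ k) has_vector_derivative cross3 \<Omega> (q t $ k)) (at t)" for k t
      unfolding q by (rule rotation_about_has_vector_derivative[OF \<Omega>0])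
    have isometry: "q t $ i \<bullet> q t $ j = vector [x, y, z] $ i \<bullet> (vector [x, y, z] $ j :: real^3)" for t i j
      using inner_constant_of_rotating[OF deriv[of i] deriv[of j], of t] by (simp add: q)
    have qq: "q t $ 1 \<bullet> q t $ 1 = 1" "q t $ 2 \<bullet> q t $ 2 = 1" "q t $ 3 \<bullet> q t $ 3 = 1"
      "q t $ 1 \<bullet> q t $ 2 = cos (\<sigma> 1 2)" "q t $ 2 \<bullet> q t $ 3 = cos (\<sigma> 2 3)"
      "q t $ 3 \<bullet> q t $ 1 = cos (\<sigma> 3 1)" for t
      by (simp_all add: isometry xyz)
    have unit: "q t $ k \<bullet> q t $ k = 1" for t k
      using qq exhaust_3[of k] by auto
    have \<Omega>q: "\<Omega> \<bullet> q t $ k = \<Omega> \<bullet> (vector [x, y, z] $ k :: real^3)" for t k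
      using inner_constant_of_rotating[OF _ deriv[of k], of "\<lambda>_. \<Omega>" t] by (simp add: q)
    \<comment> \<open>The rotation fixes its own axis, so \<Omega> keeps the coordinates
      \<open>a\<close>, \<open>b\<close>, \<open>c\<close> in the moving basis and the balance at
      time 0 persists.\<close>
    have \<Omega>t: "\<Omega> = a *\<^sub>R q t $ 1 + b *\<^sub>R q t $ 2 + c *\<^sub>R q t $ 3" for t
      using rotation_about_axis[OF \<Omega>0, of t]
      by (subst (asm) (2) \<Omega>) (simp add: q rotation_about_add rotation_about_scaleR)
    have "euler_lagrange_on_spheres (lagrangian m U) q"
      unfolding euler_lagrange_rotating_iff[OF unit deriv U qq(4-6)]
    proof (intro allI impI)
      fix t and w :: "real^3^3" assume w: "\<forall>k. w $ k \<bullet> q t $ k = 0"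
      have \<Omega>w: "\<Omega> \<bullet> w $ k = a * (q t $ 1 \<bullet> w $ k) + b * (q t $ 2 \<bullet> w $ k) + c * (q t $ 3 \<bullet> w $ k)" for k
        by (subst \<Omega>t[of t]) (simp add: inner_add_left)
      have w0: "q t $ k \<bullet> w $ k = 0" for k using w by (simp add: inner_commute)
      \<comment> \<open>Tangency removes the coefficient of the body itself, and \<open>bal\<close>
        identifies the other two with the forces.\<close>
      have f: "(\<Omega> \<bullet> q t $ 1) * (\<Omega> \<bullet> w $ 1) = m $ 2 * u12 * (q t $ 2 \<bullet> w $ 1) + m $ 3 * u31 * (q t $ 3 \<bullet> w $ 1)"
        "(\<Omega> \<bullet> q t $ 2) * (\<Omega> \<bullet> w $ 2) = m $ 1 * u12 * (q t $ 1 \<bullet> w $ 2) + m $ 3 * u23 * (q t $ 3 \<bullet> w $ 2)"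
        "(\<Omega> \<bullet> q t $ 3) * (\<Omega> \<bullet> w $ 3) = m $ 1 * u31 * (q t $ 1 \<bullet> w $ 3) + m $ 2 * u23 * (q t $ 2 \<bullet> w $ 3)"
        unfolding \<Omega>w \<Omega>q by (simp_all add: w0 distrib_left bal flip: mult.assoc)
      show "m $ 1 * ((\<Omega> \<bullet> q t $ 1) * (\<Omega> \<bullet> w $ 1)) + m $ 2 * ((\<Omega> \<bullet> q t $ 2) * (\<Omega> \<bullet> w $ 2))
          + m $ 3 * ((\<Omega> \<bullet> q t $ 3) * (\<Omega> \<bullet> w $ 3)) =
        m $ 1 * m $ 2 * u12 * (q t $ 1 \<bullet> w $ 2 + w $ 1 \<bullet> q t $ 2) +
        m $ 2 * m $ 3 * u23 * (q t $ 2 \<bullet> w $ 3 + w $ 2 \<bullet> q t $ 3) +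
        m $ 3 * m $ 1 * u31 * (q t $ 3 \<bullet> w $ 1 + w $ 3 \<bullet> q t $ 1)"
        unfolding f by (simp add: inner_commute algebra_simps)
    qed
    then have "relative_equilibrium m U q"
      unfolding relative_equilibrium_def using deriv by blast
    \<comment> \<open>The normal of a common great circle would be orthogonal to all three
      positions, making their triple product zero against \<open>0 < ?G\<close>.\<close>
    moreover have "\<not> (\<exists>C. is_great_circle C \<and> (\<forall>k. q t $ k \<in> C))" for t
    proof
      assume "\<exists>C. is_great_circle C \<and> (\<forall>k. q t $ k \<in> C)"
      then obtain n where "n \<noteq> 0" "\<And>k. n \<bullet> q t $ k = 0"
        unfolding is_great_circle_def by blast
      then have "q t $ 1 \<bullet> cross3 (q t $ 2) (q t $ 3) = 0"
        using triple_scaleR_dual_expansion[of "q t $ 1" "q t $ 2" "q t $ 3" n] by simp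
      then show False using gram[OF qq[of t]] \<open>0 < ?G\<close> by simp
    qed
    moreover have "arc_angle (q t $ i) (q t $ j) = \<sigma> i j" if "i \<noteq> j" for t i j
    proof -
      have "q t $ i \<bullet> q t $ j = cos (\<sigma> i j)"
        using that exhaust_3[of i] exhaust_3[of j] qq[of t]
        by (auto simp: sym[of 2 1] sym[of 3 2] sym[of 1 3] inner_commute)
      then show ?thesis using range[OF that] by (simp add: arc_angle_def arccos_cos)
    qed
    ultimately show "forms_lagrange_relative_equilibrium m U \<sigma>"
      unfolding forms_lagrange_relative_equilibrium_def lagrange_relative_equilibrium_def by blast
  qed
qed

end
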